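(* There exist continuous functions $$( \overline{u}_A,\overline{v}_A): \overline{\Omega}_- \to [0, 1]^2, \qquad ( \overline{u}_B,\overline{v}_B): \overline{\Omega}_- \to [0, 1]^2, \qquad ( \overline{u}_C,\overline{v}_C ): \overline{\Omega}_- \to [0, 1]^2$$ that satisfy the following properties. (i) Pick any $(a,d) \in \overline{\Omega}_-$. Then $G(\overline{u}_{\#}(a,d), \overline{v}_{\#}(a,d); a, d) = 0$ for all $\# \in \{A , B, C \}$. If also $(a, d) \in \Omega_-$, then the matrix $D_{1,2} G(\overline{u}_{\#}(a,d),\overline{v}_{\#}(a,d) ;a , d)$ has two strictly negative eigenvalues if $\# = B$, or one strictly positive and one strictly negative eigenvalue if $\# \in \{A, C \}$. (ii) For any $0 \le a \le 1$ we have the identities $$(\overline{u}_A,\overline{v}_A)(a, 0) = (0, a), \qquad (\overline{u}_B,\overline{v}_B)(a, 0) = (0, 1), \qquad (\overline{u}_C,\overline{v}_C)(a, 0) = (a, 1) .$$ (iii) For any $(a, d) \in \Omega_-$ we have the ordering $$0 < \overline{u}_A(a,d) < \overline{u}_B(a,d) < \overline{u}_C(a,d) < a < \overline{v}_A(a,d) < \overline{v}_B(a,d) < \overline{v}_C(a,d) .$$ (iv) For any $a \in [0, \frac{1}{2}]$ we have $(\overline{u}_B,\overline{v}_B)(a, d_-(a)) = (\overline{u}_C,\overline{v}_C)(a, d_-(a))$, while for any $a \in [\frac{1}{2} , 1]$ we have $(\overline{u}_A,\overline{v}_A)(a, d_-(a)) = (\overline{u}_B, \overline{v}_B )(a, 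d_-(a))$.
   Context: Let $g(u;a) = u(1-u)(u-a)$ and $G(u,v;a,d) = \big( 2d(v-u) + g(u;a),\ 2d(u-v) + g(v;a) \big)^T$; $D_{1,2}G$ is the $2\times2$ Jacobian with respect to $(u,v)$. The function $d_-:[0,1]\to[0,\frac1{24}]$ is the continuous function with $d_-(0)=d_-(1)=0$ such that, for each $a\in(0,1)$, the equation $G(u,v;a,d)=0$ has nine distinct real roots for $0\le d<d_-(a)$ and fewer than nine for $d\ge d_-(a)$. Set $\Omega_- = \{(a,d): 0<a<1,\ 0<d<d_-(a)\}$, with closure $\overline{\Omega}_- = \{(a,d): 0\le a\le 1,\ 0\le d\le d_-(a)\}$. *)

theory Defs
  imports "HOL-Analysis.Analysis"
begin

definition g :: "real \<Rightarrow> real \<Rightarrow> real" where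
  "g u a = u * (1 - u) * (u - a)"

definition G :: "real \<Rightarrow> real \<Rightarrow> real \<Rightarrow> real \<Rightarrow> real ^ 2" where
  "G u v a d = vector [2 * d * (v - u) + g u a, 2 * d * (u - v) + g v a]"

text \<open>The Jacobian of \<open>G\<close> with respect to \<open>(u, v)\<close> only, i.e. \<open>D\<^sub>1\<^sub>,\<^sub>2 G(u, v; a, d)\<close>.\<close>

definition D12_G :: "real \<Rightarrow> real \<Rightarrow> real \<Rightarrow> real \<Rightarrow> real ^ 2 ^ 2" where
  "D12_G u v a d = jacobian (\<lambda>w. G (w $ 1) (w $ 2) a d) (at (vector [u, v]))"

definition is_eigenvalue :: "real ^ 'n ^ 'n \<Rightarrow> real \<Rightarrow> bool" where
  "is_eigenvalue M l \<longleftrightarrow> (\<exists>x. x \<noteq> 0 \<and> M *v x = l *\<^sub>R x)"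

definition roots :: "real \<Rightarrow> real \<Rightarrow> (real \<times> real) set" where
  "roots a d = {(u, v). G u v a d = 0}"

text \<open>The properties characterizing \<open>d\<^sub>-\<close>. They determine its values on \<open>[0, 1]\<close>
  (see \<open>is_d_minus_unique\<close>); values outside this interval are irrelevant.
  The finiteness conjunct is needed because infinite sets have cardinality \<open>0\<close>.\<close>

definition is_d_minus :: "(real \<Rightarrow> real) \<Rightarrow> bool" where
  "is_d_minus dm \<longleftrightarrow>
     continuous_on {0..1} dm \<and> dm ` {0..1} \<subseteq> {0..1/24} \<and> dm 0 = 0 \<and> dm 1 = 0 \<and>
     (\<forall>a\<in>{0<..<1}.
        (\<forall>d. 0 \<le> d \<and> d < dm a \<longrightarrow> card (roots a d) = 9) \<and>
        (\<forall>d. dm a \<le> d \<longrightarrow> finite (roots a d) \<and> card (roots a d) < 9))"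

definition Omega_minus :: "(real \<Rightarrow> real) \<Rightarrow> (real \<times> real) set" where
  "Omega_minus dm = {(a, d). 0 < a \<and> a < 1 \<and> 0 < d \<and> d < dm a}"

lemma is_d_minusD:
  assumes "is_d_minus dm"
  shows "continuous_on {0..1} dm" "dm ` {0..1} \<subseteq> {0..1/24}" "dm 0 = 0" "dm 1 = 0"
    and "\<And>a d. a \<in> {0<..<1} \<Longrightarrow> 0 \<le> d \<Longrightarrow> d < dm a \<Longrightarrow> card (roots a d) = 9"
    and "\<And>a d. a \<in> {0<..<1} \<Longrightarrow> dm a \<le> d \<Longrightarrow> card (roots a d) < 9"
  using assms unfolding is_d_minus_def by blast+

lemma is_d_minus_unique:
  assumes "is_d_minus dm" "is_d_minus dm'" "a \<in> {0..1}"
  shows "dm a = dm' a"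
proof -
  have le: "f a \<le> h a" if f: "is_d_minus f" and h: "is_d_minus h" and a: "a \<in> {0<..<1}" for f h
  proof (rule ccontr)
    assume "\<not> f a \<le> h a"
    then have less: "h a < f a" by simp
    have "h a \<in> h ` {0..1}" by (rule imageI) (rule assms(3))
    then have "h a \<in> {0..1/24}" by (rule subsetD[OF is_d_minusD(2)[OF h]])
    then have "0 \<le> h a" by simp
    then have "card (roots a (h a)) = 9" by (rule is_d_minusD(5)[OF f a _ less])
    moreover have "card (roots a (h a)) < 9" by (rule is_d_minusD(6)[OF h a order_refl])
    ultimately show False by linarith
  qed
  consider "a = 0" | "a = 1" | "a \<in> {0<..<1}" using assms(3) by fastforce
  then show ?thesis
  proof cases
    case 1
    then show ?thesis using is_d_minusD(3) assms(1,2) by metis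
  next
    case 2
    then show ?thesis using is_d_minusD(4) assms(1,2) by metis
  next
    case 3
    then show ?thesis using le assms(1,2) by (meson order_antisym)
  qed
qed

lemma card_roots_0:
  assumes "0 < a" "a < 1"
  shows "card (roots a 0) = 9"
proof -
  have "G u v a 0 = 0 \<longleftrightarrow> g u a = 0 \<and> g v a = 0" for u v
    by (simp add: G_def vec_eq_iff forall_2)
  then have "roots a 0 = {0, a, 1} \<times> {0, a, 1}"
    by (auto simp: roots_def g_def)
  then show ?thesis using assms by (simp add: card_cartesian_product)
qed

lemma is_d_minus_pos:
  assumes "is_d_minus dm" "0 < a" "a < 1"
  shows "0 < dm a"
proof (rule ccontr)
  assume "\<not> 0 < dm a"
  then have "card (roots a 0) < 9"
    using assms by (intro is_d_minusD(6)) auto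
  then show False using card_roots_0 assms by simp
qed

lemma closure_Omega_minus:
  assumes "is_d_minus dm"
  shows "closure (Omega_minus dm) = {(a, d). 0 \<le> a \<and> a \<le> 1 \<and> 0 \<le> d \<and> d \<le> dm a}"
    (is "_ = ?K")
proof
  have cont: "continuous_on {0..1} dm" and ends: "dm 0 = 0" "dm 1 = 0"
    by (rule is_d_minusD[OF assms])+
  have "closed {p \<in> {0..1} \<times> {0..}. snd p \<le> dm (fst p)}"
    by (rule continuous_on_closed_Collect_le)
      (auto intro!: continuous_intros continuous_on_compose2[OF cont] closed_Times)
  moreover have "{p \<in> {0..1} \<times> {0..}. snd p \<le> dm (fst p)} = ?K" by auto
  ultimately have "closed ?K" by simp
  then show "closure (Omega_minus dm) \<subseteq> ?K"
    by (intro closure_minimal) (auto simp: Omega_minus_def)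
  have interior: "(a, d) \<in> closure (Omega_minus dm)"
    if "0 < a" "a < 1" "0 \<le> d" "d \<le> dm a" for a d
  proof -
    have "{a} \<times> {0<..<dm a} \<subseteq> Omega_minus dm"
      using that by (auto simp: Omega_minus_def)
    then have "closure ({a} \<times> {0<..<dm a}) \<subseteq> closure (Omega_minus dm)"
      by (rule closure_mono)
    moreover have "closure ({a} \<times> {0<..<dm a}) = {a} \<times> {0..dm a}"
      using is_d_minus_pos[OF assms] that by (simp add: closure_Times)
    ultimately show ?thesis using that by auto
  qed
  have "{0<..<1} \<times> {0} \<subseteq> closure (Omega_minus dm)"
    by (auto intro!: interior less_imp_le[OF is_d_minus_pos[OF assms]])
  then have "closure ({0<..<1} \<times> {0}) \<subseteq> closure (Omega_minus dm)"
    by (simp add: closure_minimal)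
  moreover have "closure ({0<..<1::real} \<times> {0::real}) = {0..1} \<times> {0}"
    by (simp add: closure_Times)
  ultimately have bottom: "{0..1} \<times> {0} \<subseteq> closure (Omega_minus dm)" by simp
  show "?K \<subseteq> closure (Omega_minus dm)"
  proof clarify
    fix a d assume *: "0 \<le> a" "a \<le> 1" "0 \<le> d" "d \<le> dm a"
    show "(a, d) \<in> closure (Omega_minus dm)"
    proof (cases "a = 0 \<or> a = 1")
      case True
      then have "d = 0" using * ends by auto
      then show ?thesis using bottom * by auto
    qed (use * interior in auto)
  qed
qed

end

theory Submission
  imports Defs
begin

text \<open>
  In terms of the centred sum \<open>t\<close> of \<open>u\<close> and \<open>v\<close>, the off-diagonal zeros of \<open>G\<close> are governed by a
  depressed cubic \<open>t\<^sup>3 - 3 r t + q = 0\<close>; the difference \<open>v - u > 0\<close> is then determined by \<open>t\<close>.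
  As soon as the cubic has three real roots, \<open>t\<^sup>2 \<le> 4 r\<close> makes the square of this difference
  nonnegative, so \<open>d\<^sub>-(a)\<close> is exactly where the discriminant \<open>4 r\<^sup>3 - q\<^sup>2\<close> vanishes. The branches
  A, B, C are the roots in \<open>[-2\<surd>r, -\<surd>r]\<close>, \<open>[-\<surd>r, \<surd>r]\<close>, \<open>[\<surd>r, 2\<surd>r]\<close>; each is unique in its
  interval, hence continuous up to the boundary, and on \<open>d = d\<^sub>-(a)\<close> the double root is \<open>\<surd>r\<close> or
  \<open>-\<surd>r\<close> according to the sign of \<open>q\<close>. The Jacobian has determinant \<open>-3 (v - u)\<^sup>2 (t\<^sup>2 - r)\<close>.
  The order of the roots \<open>t\<close> carries over to \<open>u\<close> and \<open>v\<close> separately because two zeros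
  cannot be nested.
\<close>

section \<open>Depressed cubics\<close>

text \<open>The intermediate value theorem gives a root for each \<open>x\<close>. Uniqueness makes
  the graph of the selection the whole solution set, which is closed, and a function into a compact
  interval with closed graph is continuous. Unlike the implicit function theorem, this also covers
  double roots at the ends of the interval.\<close>

lemma continuous_root_selection:
  fixes f :: "'a::euclidean_space \<Rightarrow> real \<Rightarrow> real"
  assumes S: "closed S"
    and f: "continuous_on (S \<times> {m..M}) (\<lambda>(x, t). f x t)"
    and lo: "continuous_on S lo" and hi: "continuous_on S hi"
    and bounds: "\<And>x. x \<in> S \<Longrightarrow> m \<le> lo x \<and> lo x \<le> hi x \<and> hi x \<le> M"
    and sign: "\<And>x. x \<in> S \<Longrightarrow> f x (lo x) * f x (hi x) \<le> 0"
    and uniq: "\<And>x t t'. x \<in> S \<Longrightarrow> t \<in> {lo x..hi x} \<Longrightarrow> t' \<in> {lo x..hi x} \<Longrightarrow>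
      f x t = 0 \<Longrightarrow> f x t' = 0 \<Longrightarrow> t = t'"
  obtains \<tau> where "continuous_on S \<tau>"
    and "\<And>x. x \<in> S \<Longrightarrow> lo x \<le> \<tau> x \<and> \<tau> x \<le> hi x \<and> f x (\<tau> x) = 0"
proof -
  have ex: "\<exists>t. lo x \<le> t \<and> t \<le> hi x \<and> f x t = 0" if x: "x \<in> S" for x
  proof -
    have "continuous_on {m..M} (\<lambda>t. f x t)"
      using continuous_on_compose2[OF f, of "{m..M}" "\<lambda>t. (x, t)"] x
      by (simp add: continuous_on_Pair image_subset_iff)
    then have c: "continuous_on {lo x..hi x} (\<lambda>t. f x t)"
      by (rule continuous_on_subset) (use bounds[OF x] in auto)
    show ?thesis
    proof (cases "f x (lo x) \<le> 0 \<and> 0 \<le> f x (hi x)")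
      case True
      then show ?thesis using IVT'[OF _ _ _ c] bounds[OF x] by blast
    next
      case False
      then have "f x (hi x) \<le> 0 \<and> 0 \<le> f x (lo x)"
        using sign[OF x] by (auto simp: mult_le_0_iff)
      then show ?thesis using IVT2'[OF _ _ _ c] bounds[OF x] by blast
    qed
  qed
  define \<tau> where "\<tau> x = (SOME t. lo x \<le> t \<and> t \<le> hi x \<and> f x t = 0)" for x
  have \<tau>: "lo x \<le> \<tau> x \<and> \<tau> x \<le> hi x \<and> f x (\<tau> x) = 0" if "x \<in> S" for x
    unfolding \<tau>_def by (rule someI_ex[OF ex[OF that]])
  \<comment> \<open>Describes the graph by closed conditions that no longer mention
    \<open>\<tau>\<close>.\<close>
  have mem: "(x, t) \<in> (\<lambda>x. (x, \<tau> x)) ` S \<longleftrightarrow>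
      x \<in> S \<and> t \<in> {m..M} \<and> lo x \<le> t \<and> t \<le> hi x \<and> f x t = 0" for x t
    using \<tau> bounds uniq by fastforce
  have closed1: "closed {p \<in> S \<times> {m..M}. lo (fst p) \<le> snd p}"
    by (rule continuous_on_closed_Collect_le)
      (auto intro!: continuous_intros continuous_on_compose2[OF lo] closed_Times S)
  have closed2: "closed {p \<in> S \<times> {m..M}. snd p \<le> hi (fst p)}"
    by (rule continuous_on_closed_Collect_le)
      (auto intro!: continuous_intros continuous_on_compose2[OF hi] closed_Times S)
  have closed3: "closed {p \<in> S \<times> {m..M}. (\<lambda>(x, t). f x t) p = 0}"
    by (rule continuous_closed_preimage_constant[OF f]) (auto intro: closed_Times S)
  have "(\<lambda>x. (x, \<tau> x)) ` S = {p \<in> S \<times> {m..M}. lo (fst p) \<le> snd p} \<inter>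
      {p \<in> S \<times> {m..M}. snd p \<le> hi (fst p)} \<inter> {p \<in> S \<times> {m..M}. (\<lambda>(x, t). f x t) p = 0}"
    by (rule set_eqI) (auto simp only: mem split_paired_all mem_Times_iff mem_Collect_eq Int_iff
        fst_conv snd_conv prod.case)
  then have "closed ((\<lambda>x. (x, \<tau> x)) ` S)"
    using closed1 closed2 closed3 by (simp only: closed_Int)
  moreover have "\<tau> \<in> S \<rightarrow> {m..M}"
    using \<tau> bounds by fastforce
  ultimately have "continuous_on S \<tau>"
    by (intro continuous_from_closed_graph[of "{m..M}"]) auto
  then show thesis using \<tau> that by blast
qed

text \<open>Normalised so that for \<open>r \<ge> 0\<close> the critical points are
  \<open>sqrt r\<close> and \<open>- sqrt r\<close>; the discriminant is
  \<open>27 * (4 * r ^ 3 - q\<^sup>2)\<close>.\<close>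

definition cubic :: "real \<Rightarrow> real \<Rightarrow> real \<Rightarrow> real" where
  "cubic r q t = t ^ 3 - 3 * r * t + q"

lemma cubic_two_roots:
  assumes "cubic r q t = 0" "cubic r q t' = 0" "t \<noteq> t'"
  shows "t\<^sup>2 + t * t' + t'\<^sup>2 = 3 * r"
proof -
  have "(t - t') * (t\<^sup>2 + t * t' + t'\<^sup>2 - 3 * r) = cubic r q t - cubic r q t'"
    by (simp add: cubic_def algebra_simps power2_eq_square power3_eq_cube)
  then show ?thesis using assms by simp
qed

text \<open>By Vieta \<open>z = - x - y\<close>, and \<open>r\<close>, \<open>q\<close> are
  polynomials in \<open>x\<close>, \<open>y\<close>. The discriminant is then the square of the
  product of the root differences.\<close>

lemma cubic_three_roots:
  assumes "cubic r q x = 0" "cubic r q y = 0" "cubic r q z = 0" "x \<noteq> y" "y \<noteq> z" "x \<noteq> z"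
  shows "q\<^sup>2 < 4 * r ^ 3"
proof -
  have xy: "x\<^sup>2 + x * y + y\<^sup>2 = 3 * r" and xz: "x\<^sup>2 + x * z + z\<^sup>2 = 3 * r"
    using cubic_two_roots assms by blast+
  have "(y - z) * (x + y + z) = (x\<^sup>2 + x * y + y\<^sup>2) - (x\<^sup>2 + x * z + z\<^sup>2)"
    by (simp add: algebra_simps power2_eq_square)
  then have z: "z = - x - y" using xy xz assms(5) by (simp add: add_eq_0_iff)
  have r: "r = (x\<^sup>2 + x * y + y\<^sup>2) / 3" using xy by simp
  have q: "q = x * y * (x + y)"
    using assms(1) unfolding cubic_def r by (simp add: field_simps power2_eq_square power3_eq_cube)
  have "27 * (4 * r ^ 3 - q\<^sup>2) = ((x - y) * (y - z) * (x - z))\<^sup>2"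
    unfolding r q z by (simp add: field_simps power2_eq_square power3_eq_cube)
  also have "\<dots> > 0" using assms(4-6) by simp
  finally show ?thesis by simp
qed

lemma abs_le_2_sqrt_cube:
  assumes "0 \<le> r" "q\<^sup>2 \<le> 4 * r ^ 3"
  shows "\<bar>q\<bar> \<le> 2 * sqrt r ^ 3"
proof -
  have "(sqrt r ^ 3)\<^sup>2 = r ^ 3"
    by (metis assms(1) mult.commute power_mult real_sqrt_pow2)
  then have "\<bar>q\<bar>\<^sup>2 \<le> (2 * sqrt r ^ 3)\<^sup>2"
    using assms by (simp add: power_mult_distrib)
  then show ?thesis by (rule power2_le_imp_le) (simp add: assms)
qed

text \<open>The value at \<open>2 * sqrt r\<close> agrees with that at the critical point
  \<open>- sqrt r\<close>, and symmetrically. These four points bound the intervals in which the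
  roots are sought.\<close>

lemma cubic_at_sqrt:
  assumes "0 \<le> r"
  shows "cubic r q (sqrt r) = q - 2 * sqrt r ^ 3" "cubic r q (- sqrt r) = q + 2 * sqrt r ^ 3"
    "cubic r q (2 * sqrt r) = q + 2 * sqrt r ^ 3" "cubic r q (- (2 * sqrt r)) = q - 2 * sqrt r ^ 3"
proof -
  have "r = sqrt r * sqrt r" using assms by simp
  then show "cubic r q (sqrt r) = q - 2 * sqrt r ^ 3" "cubic r q (- sqrt r) = q + 2 * sqrt r ^ 3"
    "cubic r q (2 * sqrt r) = q + 2 * sqrt r ^ 3" "cubic r q (- (2 * sqrt r)) = q - 2 * sqrt r ^ 3"
    unfolding cubic_def by (simp_all add: power3_eq_cube algebra_simps)
qed

text \<open>Distinct roots satisfy \<open>t\<^sup>2 + t * t' + t'\<^sup>2 = 3 * r\<close>. In an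
  outer interval \<open>t * t' \<ge> r\<close> makes the left side too large; in the middle one both
  squares are at most \<open>r\<close>, which makes it too small.\<close>

lemma cubic_root_unique:
  assumes "0 \<le> r" "cubic r q t = 0" "cubic r q t' = 0"
    and "t \<le> - sqrt r \<and> t' \<le> - sqrt r \<or> \<bar>t\<bar> \<le> sqrt r \<and> \<bar>t'\<bar> \<le> sqrt r \<or> sqrt r \<le> t \<and> sqrt r \<le> t'"
  shows "t = t'"
proof (rule ccontr)
  assume ne: "t \<noteq> t'"
  have e: "t\<^sup>2 + t * t' + t'\<^sup>2 = 3 * r"
    using cubic_two_roots assms(2,3) ne by blast
  have rr: "r = sqrt r * sqrt r" using assms(1) by simp
  have p: "0 \<le> sqrt r" using assms(1) by simp
  have sq: "(t - t')\<^sup>2 > 0" using ne by simp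
  consider "t * t' \<ge> r" | "\<bar>t\<bar> \<le> sqrt r" "\<bar>t'\<bar> \<le> sqrt r"
  proof -
    have "t * t' \<ge> r" if "sqrt r \<le> t" "sqrt r \<le> t'"
      using mult_mono[OF that] p that rr by simp
    moreover have "t * t' \<ge> r" if "t \<le> - sqrt r" "t' \<le> - sqrt r"
      using mult_mono[of "sqrt r" "- t" "sqrt r" "- t'"] p that rr by simp
    ultimately show ?thesis using assms(4) that by blast
  qed
  then show False
  proof cases
    case 1
    have "3 * (t * t') < t\<^sup>2 + t * t' + t'\<^sup>2"
      using sq by (simp add: power2_eq_square algebra_simps)
    then show False using 1 e by linarith
  next
    case 2
    have "t\<^sup>2 \<le> r" "t'\<^sup>2 \<le> r"
      using 2 assms(1) by (metis abs_le_square_iff abs_of_nonneg p real_sqrt_pow2)+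
    moreover have "t\<^sup>2 + t * t' + t'\<^sup>2 < 3 / 2 * (t\<^sup>2 + t'\<^sup>2)"
      using sq by (simp add: power2_eq_square algebra_simps)
    ultimately show False using e by argo
  qed
qed

definition three_real :: "(real \<times> real) set" where
  "three_real = {(r, q). 0 \<le> r \<and> r \<le> 1 \<and> q\<^sup>2 \<le> 4 * r ^ 3}"

lemma closed_three_real: "closed three_real"
  unfolding three_real_def case_prod_unfold
  by (intro closed_Collect_conj closed_Collect_le continuous_intros)

text \<open>At the four points -2s, -s, s, 2s with \<open>s = sqrt r\<close> the cubic alternates
  between \<open>q - 2 * s ^ 3 \<le> 0\<close> and \<open>q + 2 * s ^ 3 \<ge> 0\<close>, so each of
  the three intervals contains a root.\<close>

lemma cubic_roots_continuous:
  obtains x y z :: "real \<times> real \<Rightarrow> real"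
  where "continuous_on three_real x" "continuous_on three_real y" "continuous_on three_real z"
    and "\<And>r q. (r, q) \<in> three_real \<Longrightarrow>
      cubic r q (x (r, q)) = 0 \<and> - (2 * sqrt r) \<le> x (r, q) \<and> x (r, q) \<le> - sqrt r \<and>
      cubic r q (y (r, q)) = 0 \<and> - sqrt r \<le> y (r, q) \<and> y (r, q) \<le> sqrt r \<and>
      cubic r q (z (r, q)) = 0 \<and> sqrt r \<le> z (r, q) \<and> z (r, q) \<le> 2 * sqrt r"
proof -
  have sel: "\<exists>\<tau>. continuous_on three_real \<tau> \<and> (\<forall>p\<in>three_real.
      \<alpha> * sqrt (fst p) \<le> \<tau> p \<and> \<tau> p \<le> \<beta> * sqrt (fst p) \<and> cubic (fst p) (snd p) (\<tau> p) = 0)"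
    if \<alpha>\<beta>: "(\<alpha>, \<beta>) \<in> {(-2, -1), (-1, 1), (1, 2)}" for \<alpha> \<beta> :: real
  proof (rule continuous_root_selection[of three_real "-2" 2 "\<lambda>p. cubic (fst p) (snd p)"
        "\<lambda>p. \<alpha> * sqrt (fst p)" "\<lambda>p. \<beta> * sqrt (fst p)"])
    show "continuous_on (three_real \<times> {- 2..2}) (\<lambda>(p, t). cubic (fst p) (snd p) t)"
      unfolding cubic_def case_prod_unfold by (intro continuous_intros)
  next
    fix p assume p: "p \<in> three_real"
    then have r: "0 \<le> fst p" "fst p \<le> 1" and q: "\<bar>snd p\<bar> \<le> 2 * sqrt (fst p) ^ 3"
      using abs_le_2_sqrt_cube[of "fst p" "snd p"] by (auto simp: three_real_def)
    have "- 2 \<le> \<alpha> * s \<and> \<alpha> * s \<le> \<beta> * s \<and> \<beta> * s \<le> 2" if "0 \<le> s" "s \<le> 1" for s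
      using \<alpha>\<beta> that by auto
    then show "- 2 \<le> \<alpha> * sqrt (fst p) \<and> \<alpha> * sqrt (fst p) \<le> \<beta> * sqrt (fst p) \<and>
        \<beta> * sqrt (fst p) \<le> 2"
      using r by simp
    show "cubic (fst p) (snd p) (\<alpha> * sqrt (fst p)) * cubic (fst p) (snd p) (\<beta> * sqrt (fst p)) \<le> 0"
      using \<alpha>\<beta> q
      by (elim insertE emptyE) (simp_all add: cubic_at_sqrt[OF r(1)] mult_le_0_iff abs_le_iff)
    fix t t' assume "t \<in> {\<alpha> * sqrt (fst p)..\<beta> * sqrt (fst p)}"
      "t' \<in> {\<alpha> * sqrt (fst p)..\<beta> * sqrt (fst p)}"
      "cubic (fst p) (snd p) t = 0" "cubic (fst p) (snd p) t' = 0"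
    moreover from this have "t \<le> - sqrt (fst p) \<and> t' \<le> - sqrt (fst p) \<or>
        \<bar>t\<bar> \<le> sqrt (fst p) \<and> \<bar>t'\<bar> \<le> sqrt (fst p) \<or> sqrt (fst p) \<le> t \<and> sqrt (fst p) \<le> t'"
      using \<alpha>\<beta> by (elim insertE emptyE) (simp_all add: abs_le_iff)
    ultimately show "t = t'"
      using cubic_root_unique[OF r(1), of "snd p" t t'] by blast
  next
    fix \<tau> assume "continuous_on three_real \<tau>" "\<And>p. p \<in> three_real \<Longrightarrow> \<alpha> * sqrt (fst p) \<le> \<tau> p \<and>
      \<tau> p \<le> \<beta> * sqrt (fst p) \<and> cubic (fst p) (snd p) (\<tau> p) = 0"
    then show ?thesis by blast
  qed (intro closed_three_real continuous_intros)+
  obtain x y z where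
    "continuous_on three_real x" "\<forall>p\<in>three_real. (-2) * sqrt (fst p) \<le> x p \<and>
      x p \<le> (-1) * sqrt (fst p) \<and> cubic (fst p) (snd p) (x p) = 0"
    "continuous_on three_real y" "\<forall>p\<in>three_real. (-1) * sqrt (fst p) \<le> y p \<and>
      y p \<le> 1 * sqrt (fst p) \<and> cubic (fst p) (snd p) (y p) = 0"
    "continuous_on three_real z" "\<forall>p\<in>three_real. 1 * sqrt (fst p) \<le> z p \<and>
      z p \<le> 2 * sqrt (fst p) \<and> cubic (fst p) (snd p) (z p) = 0"
    using sel[of "-2" "-1"] sel[of "-1" 1] sel[of 1 2] by auto
  then show thesis by (intro that[of x y z]) force+
qed

lemma sqrt_cube_square: "0 \<le> r \<Longrightarrow> (2 * sqrt r ^ 3)\<^sup>2 = 4 * r ^ 3"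
proof -
  assume "0 \<le> r"
  then have "(sqrt r ^ 3)\<^sup>2 = r ^ 3"
    by (metis mult.commute power_mult real_sqrt_pow2)
  then show ?thesis by (simp only: power_mult_distrib) simp
qed

text \<open>Here \<open>q\<close> is \<open>2 * sqrt r ^ 3\<close> up to sign, and the sign decides
  at which critical point the cubic vanishes.\<close>

lemma cubic_double_root:
  assumes "0 \<le> r" "q\<^sup>2 = 4 * r ^ 3"
  shows "0 \<le> q \<Longrightarrow> cubic r q (sqrt r) = 0" "q \<le> 0 \<Longrightarrow> cubic r q (- sqrt r) = 0"
proof -
  have "q\<^sup>2 = (2 * sqrt r ^ 3)\<^sup>2" using assms sqrt_cube_square by simp
  then have "q = 2 * sqrt r ^ 3 \<or> q = - (2 * sqrt r ^ 3)" by (simp only: power2_eq_iff)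
  moreover have "0 \<le> 2 * sqrt r ^ 3" using assms(1) by simp
  ultimately show "0 \<le> q \<Longrightarrow> cubic r q (sqrt r) = 0" "q \<le> 0 \<Longrightarrow> cubic r q (- sqrt r) = 0"
    unfolding cubic_at_sqrt(1,2)[OF assms(1), of q] by linarith+
qed

text \<open>A zero at a critical point would be a double root and force
  \<open>q\<^sup>2 = 4 * r ^ 3\<close>. This later makes the bounds on the roots strict.\<close>

lemma cubic_sqrt_nonzero:
  assumes "0 \<le> r" "q\<^sup>2 < 4 * r ^ 3"
  shows "cubic r q (sqrt r) \<noteq> 0" "cubic r q (- sqrt r) \<noteq> 0"
proof -
  have "q\<^sup>2 \<noteq> (2 * sqrt r ^ 3)\<^sup>2"
    using assms sqrt_cube_square by simp
  then have "q \<noteq> 2 * sqrt r ^ 3" "q \<noteq> - (2 * sqrt r ^ 3)" by auto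
  then show "cubic r q (sqrt r) \<noteq> 0" "cubic r q (- sqrt r) \<noteq> 0"
    unfolding cubic_at_sqrt(1,2)[OF assms(1), of q] by linarith+
qed

lemma nonneg_if_square_le_cube: "(q::real)\<^sup>2 \<le> 4 * r ^ 3 \<Longrightarrow> 0 \<le> r"
proof (rule ccontr)
  assume "q\<^sup>2 \<le> 4 * r ^ 3" "\<not> 0 \<le> r"
  then have "r * r\<^sup>2 < 0" by (intro mult_neg_pos) auto
  moreover have "r ^ 3 = r * r\<^sup>2" by (simp add: power2_eq_square power3_eq_cube)
  ultimately show False
    using zero_le_power2[of q] \<open>q\<^sup>2 \<le> 4 * r ^ 3\<close> by linarith
qed

section \<open>Zeros of \<open>G\<close> off the diagonal\<close>

lemma G_eq_0_iff: "G u v a d = 0 \<longleftrightarrow> 2 * d * (v - u) + g u a = 0 \<and> 2 * d * (u - v) + g v a = 0"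
  by (simp add: G_def vec_eq_iff forall_2)

text \<open>With \<open>t = u + v - 2 (1 + a) / 3\<close> and \<open>h = (v - u) / 2\<close>, a zero \<open>(u, v)\<close> of \<open>G\<close> with
  \<open>u \<noteq> v\<close> is the same as a root \<open>t\<close> of the cubic with parameters \<open>rad a d\<close>, \<open>off a\<close> together
  with \<open>h\<^sup>2 = gap2 a d t\<close>. Only \<open>rad\<close> depends on \<open>d\<close>.\<close>

definition rad :: "real \<Rightarrow> real \<Rightarrow> real" where
  "rad a d = (1 - a + a\<^sup>2) / 9 - 2 * d"

definition off :: "real \<Rightarrow> real" where
  "off a = (2 - a) * (1 - 2 * a) * (1 + a) / 27"

definition gap2 :: "real \<Rightarrow> real \<Rightarrow> real \<Rightarrow> real" where
  "gap2 a d t = 3 * rad a d - 3 * t\<^sup>2 / 4 + 2 * d"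

text \<open>The shift by \<open>(1 + a) / 3\<close>, the mean of the zeros 0, a, 1 of
  \<open>g\<close>, removes the quadratic term. The difference of the components of \<open>G\<close>
  has the factor \<open>h\<close>, so off the diagonal it forces
  \<open>h\<^sup>2 = gap2 a d t\<close>; the sum then reduces to the cubic.\<close>

lemma G_mean_gap:
  fixes a d t h :: real
  defines "u \<equiv> (1 + a) / 3 + t / 2 - h" and "v \<equiv> (1 + a) / 3 + t / 2 + h"
  shows "(2 * d * (v - u) + g u a) + (2 * d * (u - v) + g v a) =
      2 * cubic (rad a d) (off a) t + 3 * t * (gap2 a d t - h\<^sup>2)"
    and "(2 * d * (u - v) + g v a) - (2 * d * (v - u) + g u a) = 2 * h * (gap2 a d t - h\<^sup>2)"
  unfolding u_def v_def g_def gap2_def rad_def off_def cubic_def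
  by (simp_all add: field_simps power2_eq_square power3_eq_cube)

lemma G_zeroI:
  assumes "cubic (rad a d) (off a) t = 0" "h\<^sup>2 = gap2 a d t"
  shows "G ((1 + a) / 3 + t / 2 - h) ((1 + a) / 3 + t / 2 + h) a d = 0"
proof -
  have *: "x = 0 \<and> y = 0" if "x + y = 0" "y - x = 0" for x y :: real using that by auto
  show ?thesis unfolding G_eq_0_iff
    by (rule *) (simp_all only: G_mean_gap assms diff_self mult_zero_right add_0_right)
qed

lemma G_zeroD:
  assumes "G u v a d = 0" "u \<noteq> v"
  defines "t \<equiv> u + v - 2 * (1 + a) / 3"
  shows "cubic (rad a d) (off a) t = 0" "((v - u) / 2)\<^sup>2 = gap2 a d t"
proof -
  have u: "u = (1 + a) / 3 + t / 2 - (v - u) / 2" and v: "v = (1 + a) / 3 + t / 2 + (v - u) / 2"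
    unfolding t_def by (simp_all add: field_simps)
  have e: "2 * d * (v - u) + g u a = 0" "2 * d * (u - v) + g v a = 0"
    using assms(1) by (simp_all add: G_eq_0_iff)
  show *: "((v - u) / 2)\<^sup>2 = gap2 a d t"
    using G_mean_gap(2)[of d a t "(v - u) / 2", folded u v] assms(2) unfolding e by simp
  show "cubic (rad a d) (off a) t = 0"
    using G_mean_gap(1)[of d a t "(v - u) / 2", folded u v] unfolding e * by simp
qed

text \<open>Since \<open>d * (v - u) > 0\<close>, the equations force
  \<open>g u a < 0 < g v a\<close>; the sign pattern of \<open>g\<close> together with
  \<open>u < v\<close> leaves only this position.\<close>

lemma G_zero_location:
  assumes "G u v a d = 0" "u < v" "0 < d" "0 < a" "a < 1"
  shows "0 < u" "u < a" "a < v" "v < 1"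
proof -
  have "g u a < 0" and gv: "g v a > 0"
    using assms(1) mult_strict_left_mono[OF assms(2,3)]
    unfolding G_eq_0_iff right_diff_distrib by linarith+
  then have u: "(0 < u \<and> u < a) \<or> u > 1" and v: "v < 0 \<or> (a < v \<and> v < 1)"
    unfolding g_def using assms(4,5) by (auto simp: zero_less_mult_iff mult_less_0_iff)
  then show "0 < u" "u < a" "a < v" "v < 1" using assms by linarith+
qed

text \<open>The larger sum means that at least one coordinate increases. If the other decreased, one
  of the intervals from \<open>u\<close> to \<open>v\<close> and from \<open>u'\<close> to
  \<open>v'\<close> would lie strictly inside the other, which a divided difference of
  \<open>g\<close> excludes.\<close>

lemma G_zeros_comonotone:
  assumes G: "G u v a d = 0" "G u' v' a d = 0" and "u < v" "u' < v'" "0 < d"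
    and s: "u + v < u' + v'"
  shows "u < u' \<and> v < v'"
proof -
  have no_nesting: False
    if G: "G u v a d = 0" "G u' v' a d = 0" and "u < u'" "u' < v'" "v' < v" for u v u' v'
  proof -
    define \<alpha> \<beta> w where "\<alpha> = u' - u" "\<beta> = v - v'" "w = v' - u'"
    then have pos: "0 < \<alpha>" "0 < \<beta>" "0 < w" using that by auto
    have eqs: "g u a = - 2 * d * (w + \<alpha> + \<beta>)" "g u' a = - 2 * d * w"
       "g v' a = 2 * d * w" "g v a = 2 * d * (w + \<alpha> + \<beta>)"
      using G unfolding G_eq_0_iff \<alpha>_\<beta>_w_def by (auto simp: algebra_simps)
    \<comment> \<open>The third divided difference of \<open>g\<close> at \<open>u, u', v', v\<close> is \<open>-1\<close>; denominators cleared.\<close>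
    have "- ((w + \<alpha> + \<beta>) * (\<alpha> * \<beta> * (w + \<alpha>) * (w + \<beta>) * w)) =
        g v a * (\<alpha> * w * (w + \<alpha>)) - g v' a * (\<alpha> * (w + \<beta>) * (w + \<alpha> + \<beta>))
        + g u' a * (\<beta> * (w + \<alpha>) * (w + \<alpha> + \<beta>)) - g u a * (\<beta> * w * (w + \<beta>))"
      unfolding g_def \<alpha>_\<beta>_w_def by algebra
    \<comment> \<open>The values that \<open>G = 0\<close> prescribes for \<open>g\<close> collapse
      the sum to a nonnegative multiple of a square, while the left side is negative.\<close>
    also have "\<dots> = 2 * d * w * (\<alpha> - \<beta>)\<^sup>2 * (w + \<alpha> + \<beta>)"
      unfolding eqs by algebra
    finally have "- ((w + \<alpha> + \<beta>) * (\<alpha> * \<beta> * (w + \<alpha>) * (w + \<beta>) * w)) \<ge> 0"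
      using pos \<open>0 < d\<close> by simp
    moreover have "(w + \<alpha> + \<beta>) * (\<alpha> * \<beta> * (w + \<alpha>) * (w + \<beta>) * w) > 0"
      using pos by simp
    ultimately show False by linarith
  qed
  have e: "2 * d * (v - u) = - g u a" "2 * d * (v' - u') = - g u' a"
      "2 * d * (u - v) = - g v a" "2 * d * (u' - v') = - g v' a"
    using G unfolding G_eq_0_iff by linarith+
  \<comment> \<open>For \<open>d > 0\<close> either coordinate of a zero determines the other; this
    rules out ties.\<close>
  have v: "v = v'" if "u = u'"
  proof -
    have "2 * d * (v - u') = 2 * d * (v' - u')" using e(1,2) unfolding that by linarith
    then show ?thesis using \<open>0 < d\<close> by simp
  qed
  have u: "u = u'" if "v = v'"
  proof -
    have "2 * d * (u - v') = 2 * d * (u' - v')" using e(3,4) unfolding that by linarith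
    then show ?thesis using \<open>0 < d\<close> by simp
  qed
  show ?thesis
  proof (cases "u < u'")
    case True
    then have "\<not> v' < v" using no_nesting[OF G] assms(4) by blast
    then show ?thesis using True u by force
  next
    case False
    then have "v < v'" using s by linarith
    then have "\<not> u' < u" using no_nesting[OF G(2) G(1)] assms(3) by blast
    then show ?thesis using False v \<open>v < v'\<close> by force
  qed
qed

section \<open>Number of zeros and sign of the discriminant\<close>

text \<open>Three zeros lie on the diagonal and the others come in pairs under swapping, so nine
  zeros include at least three with \<open>u < v\<close>. Their values of \<open>t\<close> are
  distinct, because \<open>t\<close> determines the positive half gap, and are roots of the
  cubic.\<close>

lemma card_roots_9_imp:
  assumes "card (roots a d) = 9"
  shows "(off a)\<^sup>2 < 4 * rad a d ^ 3"
proof -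
  define L where "L = {(u, v) \<in> roots a d. u < v}"
  have fin: "finite (roots a d)" using assms card.infinite by fastforce
  then have finL: "finite L" by (rule rev_finite_subset) (auto simp: L_def)
  have "roots a d \<subseteq> {(0, 0), (a, a), (1, 1)} \<union> (L \<union> prod.swap ` L)"
  proof (rule subrelI)
    fix u v assume uv: "(u, v) \<in> roots a d"
    then have vu: "(v, u) \<in> roots a d" by (simp add: roots_def G_eq_0_iff)
    consider "u = v" | "(u, v) \<in> L" | "(v, u) \<in> L"
      using uv vu by (fastforce simp: L_def)
    then show "(u, v) \<in> {(0, 0), (a, a), (1, 1)} \<union> (L \<union> prod.swap ` L)"
    proof cases
      case 1
      then show ?thesis using uv by (auto simp: roots_def G_eq_0_iff g_def)
    qed force+
  qed
  then have "card (roots a d) \<le> card ({(0, 0), (a, a), (1, 1)} \<union> (L \<union> prod.swap ` L))"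
    by (intro card_mono) (auto simp: finL)
  also have "\<dots> \<le> card {(0, 0), (a, a), (1, 1)} + card (L \<union> prod.swap ` L)"
    by (rule card_Un_le)
  also have "\<dots> \<le> 3 + (card L + card (prod.swap ` L))"
    by (intro add_mono card_Un_le) (simp add: card_insert_if)
  also have "\<dots> \<le> 3 + (card L + card L)"
    using finL by (intro add_mono card_image_le) auto
  finally have "3 \<le> card L" using assms by simp
  then obtain T where T: "T \<subseteq> L" "card T = 3" by (meson obtain_subset_with_card_n)
  define t where "t p = fst p + snd p - 2 * (1 + a) / 3" for p :: "real \<times> real"
  have root: "cubic (rad a d) (off a) (t p) = 0"
    and gap: "((snd p - fst p) / 2)\<^sup>2 = gap2 a d (t p)" if "p \<in> L" for p
    using that G_zeroD[of "fst p" "snd p" a d] by (auto simp: L_def roots_def t_def)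
  have "inj_on t L"
  proof
    fix p p' assume p: "p \<in> L" "p' \<in> L" "t p = t p'"
    then have "((snd p - fst p) / 2)\<^sup>2 = ((snd p' - fst p') / 2)\<^sup>2"
      using gap by metis
    moreover have "0 \<le> (snd p - fst p) / 2" "0 \<le> (snd p' - fst p') / 2"
      using p by (auto simp: L_def)
    ultimately have "(snd p - fst p) / 2 = (snd p' - fst p') / 2" by simp
    moreover have "fst p + snd p = fst p' + snd p'"
      using p(3) by (simp add: t_def)
    ultimately show "p = p'" by (simp add: prod_eq_iff)
  qed
  then have "card (t ` T) = 3"
    using T by (metis card_image inj_on_subset)
  then obtain x y z where xyz: "t ` T = {x, y, z}" "x \<noteq> y" "y \<noteq> z" "x \<noteq> z"
    unfolding card_3_iff by blast
  have "cubic (rad a d) (off a) s = 0" if "s \<in> {x, y, z}" for s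
    using that root T(1) unfolding xyz(1)[symmetric] by blast
  then show ?thesis
    using cubic_three_roots[of _ _ x y z] xyz by blast
qed

lemma rad_le: "0 \<le> a \<Longrightarrow> a \<le> 1 \<Longrightarrow> 0 \<le> d \<Longrightarrow> rad a d \<le> 1 / 9"
  using mult_left_le[of a a] unfolding rad_def power2_eq_square by argo

text \<open>For \<open>d > 0\<close> every cubic root in this range therefore yields a real zero of
  \<open>G\<close> with \<open>u < v\<close>.\<close>

lemma gap2_ge:
  assumes "\<bar>t\<bar> \<le> 2 * sqrt (rad a d)" "0 \<le> rad a d"
  shows "2 * d \<le> gap2 a d t"
proof -
  have "t\<^sup>2 \<le> (2 * sqrt (rad a d))\<^sup>2"
    using power_mono[OF assms(1) abs_ge_zero, of 2] by simp
  then show ?thesis using assms(2) by (simp add: gap2_def power_mult_distrib)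
qed

text \<open>The three distinct cubic roots give three zeros with \<open>u < v\<close>; their mirror
  images and the diagonal zeros bring the count to nine. Finiteness lets \<open>card\<close> be
  compared with that of a subset.\<close>

lemma nine_le_card_roots:
  assumes a: "0 < a" "a < 1" and d: "0 < d" and disc: "(off a)\<^sup>2 < 4 * rad a d ^ 3"
    and fin: "finite (roots a d)"
  shows "9 \<le> card (roots a d)"
proof -
  have r: "0 \<le> rad a d" using nonneg_if_square_le_cube[of "off a"] disc by simp
  have "(rad a d, off a) \<in> three_real"
    using disc r rad_le[of a d] a d by (simp add: three_real_def)
  then obtain x y z where
    roots: "cubic (rad a d) (off a) x = 0" "cubic (rad a d) (off a) y = 0"
      "cubic (rad a d) (off a) z = 0"
    and le: "- (2 * sqrt (rad a d)) \<le> x" "x \<le> - sqrt (rad a d)" "- sqrt (rad a d) \<le> y"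
      "y \<le> sqrt (rad a d)" "sqrt (rad a d) \<le> z" "z \<le> 2 * sqrt (rad a d)"
    using cubic_roots_continuous by metis
  note nz = cubic_sqrt_nonzero[OF r disc]
  have "x \<noteq> - sqrt (rad a d)" "y \<noteq> sqrt (rad a d)" using nz roots by auto
  then have less: "x < y" "y < z" using le by linarith+
  define pt where "pt t = ((1 + a) / 3 + t / 2 - sqrt (gap2 a d t),
    (1 + a) / 3 + t / 2 + sqrt (gap2 a d t))" for t
  define L where "L = pt ` {x, y, z}"
  have "inj pt"
    by (rule injI) (auto simp: pt_def)
  then have "card L = card {x, y, z}"
    unfolding L_def by (intro card_image) (simp add: inj_on_def)
  also have "\<dots> = 3" using less by simp
  finally have cL: "card L = 3" .
  have L: "u < v \<and> G u v a d = 0" if "(u, v) \<in> L" for u v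
  proof -
    obtain t where t: "t \<in> {x, y, z}" "(u, v) = pt t" using \<open>(u, v) \<in> L\<close> by (auto simp: L_def)
    have "\<bar>t\<bar> \<le> 2 * sqrt (rad a d)" using t(1) le r real_sqrt_ge_zero[OF r] by auto
    then have "0 < gap2 a d t" using gap2_ge[of t a d] r d by linarith
    then show ?thesis
      using t roots G_zeroI[of a d t "sqrt (gap2 a d t)"] by (auto simp: pt_def)
  qed
  have less: "fst p < snd p" if "p \<in> L" for p
    using L[of "fst p" "snd p"] that by simp
  have gt: "snd p < fst p" if "p \<in> prod.swap ` L" for p
    using that less by force
  have fL: "finite L" by (simp add: L_def)
  define D where "D = {(0, 0), (a, a), (1, 1)}"
  have D: "card D = 3" "finite D" "\<And>p. p \<in> D \<Longrightarrow> fst p = snd p"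
    using a by (auto simp: D_def)
  have "L \<inter> prod.swap ` L = {}" "D \<inter> (L \<union> prod.swap ` L) = {}"
    using less gt D(3) less_asym by (metis Un_iff disjoint_iff)+
  then have "card (D \<union> (L \<union> prod.swap ` L)) = 9"
    using fL cL D by (simp add: card_Un_disjoint card_image)
  moreover have "D \<union> (L \<union> prod.swap ` L) \<subseteq> roots a d"
  proof -
    have "D \<subseteq> roots a d" by (auto simp: D_def roots_def G_eq_0_iff g_def)
    moreover have "L \<subseteq> roots a d" using L by (auto simp: roots_def)
    moreover have "prod.swap p \<in> roots a d" if "p \<in> roots a d" for p
      using that by (auto simp: roots_def G_eq_0_iff)
    ultimately show ?thesis by blast
  qed
  ultimately show ?thesis using card_mono[OF fin] by metis
qed

text \<open>Fewer than nine zeros at \<open>dm a\<close> exclude a positive discriminant, and nine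
  zeros for every smaller \<open>d\<close> give the opposite inequality in the limit from below. The
  endpoints 0 and 1 are computed directly.\<close>

lemma disc_at_d_minus:
  assumes dm: "is_d_minus dm" and a: "a \<in> {0..1}"
  shows "(off a)\<^sup>2 = 4 * rad a (dm a) ^ 3"
proof (cases "a = 0 \<or> a = 1")
  case True
  then show ?thesis
    using is_d_minusD(3,4)[OF dm] by (auto simp: off_def rad_def power2_eq_square power3_eq_cube)
next
  case False
  then have a: "0 < a" "a < 1" using a by auto
  have pos: "0 < dm a" by (rule is_d_minus_pos[OF dm a])
  have fin: "finite (roots a (dm a))" "card (roots a (dm a)) < 9"
    using dm a unfolding is_d_minus_def by auto
  have "\<not> (off a)\<^sup>2 < 4 * rad a (dm a) ^ 3"
    using nine_le_card_roots[OF a pos _ fin(1)] fin(2) by linarith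
  moreover have "(off a)\<^sup>2 \<le> 4 * rad a (dm a) ^ 3"
  proof (rule tendsto_lowerbound[where F = "at_left (dm a)"])
    show "((\<lambda>d. 4 * rad a d ^ 3) \<longlongrightarrow> 4 * rad a (dm a) ^ 3) (at_left (dm a))"
      unfolding rad_def by (intro tendsto_intros)
    have "\<forall>\<^sub>F d in at_left (dm a). d \<in> {0<..<dm a}"
      using pos by (rule eventually_at_left_real)
    then show "\<forall>\<^sub>F d in at_left (dm a). (off a)\<^sup>2 \<le> 4 * rad a d ^ 3"
    proof eventually_elim
      case (elim d)
      then have "card (roots a d) = 9" using is_d_minusD(5)[OF dm] a by simp
      then show ?case using card_roots_9_imp by (simp add: less_imp_le)
    qed
  qed simp
  ultimately show ?thesis by simp
qed

section \<open>Eigenvalues of the Jacobian\<close>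

text \<open>The vector \<open>(y, l - x)\<close> is an eigenvector: the first row holds identically,
  and the second is the characteristic equation.\<close>

lemma is_eigenvalue_sym2:
  fixes x y z l :: real
  assumes "y \<noteq> 0" "l * l - (x + z) * l + (x * z - y * y) = 0"
  shows "is_eigenvalue (vector [vector [x, y], vector [y, z]] :: real ^ 2 ^ 2) l"
proof -
  define w :: "real ^ 2" where "w = vector [y, l - x]"
  define M :: "real ^ 2 ^ 2" where "M = vector [vector [x, y], vector [y, z]]"
  have w: "w $ 1 = y" "w $ 2 = l - x" by (simp_all add: w_def)
  have "(M *v w) $ 1 = x * y + y * (l - x)" "(M *v w) $ 2 = y * y + z * (l - x)"
    by (simp_all add: M_def w matrix_vector_mult_def sum_2)
  moreover have "l * (l - x) - (y * y + z * (l - x)) = l * l - (x + z) * l + (x * z - y * y)"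
    "l * y = x * y + y * (l - x)"
    by (simp_all add: algebra_simps)
  ultimately have "(M *v w) $ 1 = l * w $ 1" "(M *v w) $ 2 = l * w $ 2"
    using assms(2) unfolding w by linarith+
  then have "M *v w = l *\<^sub>R w"
    unfolding vec_eq_iff forall_2 vector_scaleR_component by simp
  moreover have "w \<noteq> 0" using w(1) assms(1) by auto
  ultimately have "w \<noteq> 0 \<and> M *v w = l *\<^sub>R w" by (rule conjI[rotated])
  then show ?thesis unfolding is_eigenvalue_def M_def by (rule exI)
qed

lemma eigenvalues_sym2:
  fixes x y z :: real
  assumes y: "y \<noteq> 0"
  defines "M \<equiv> vector [vector [x, y], vector [y, z]] :: real ^ 2 ^ 2"
  shows "x * z - y * y < 0 \<Longrightarrow> \<exists>l m. 0 < l \<and> m < 0 \<and> is_eigenvalue M l \<and> is_eigenvalue M m"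
    and "0 < x * z - y * y \<Longrightarrow> x + z < 0 \<Longrightarrow>
      \<exists>l m. l \<noteq> m \<and> l < 0 \<and> m < 0 \<and> is_eigenvalue M l \<and> is_eigenvalue M m"
proof -
  \<comment> \<open>Root of the discriminant of the characteristic polynomial. As a sum of squares
    it is visibly positive, so the two eigenvalues are distinct.\<close>
  define s where "s = sqrt ((x - z)\<^sup>2 + 4 * y\<^sup>2)"
  have "(x - z)\<^sup>2 + 4 * y\<^sup>2 > 0" using y by (simp add: add_nonneg_pos)
  then have s: "0 < s" and ss: "s * s = (x - z)\<^sup>2 + 4 * y\<^sup>2" unfolding s_def by simp_all
  have s2: "s\<^sup>2 = (x + z)\<^sup>2 - 4 * (x * z - y * y)"
    using ss by (simp add: power2_eq_square algebra_simps)
  have eig: "is_eigenvalue M ((x + z + s) / 2)" "is_eigenvalue M ((x + z - s) / 2)"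
  proof -
    have "((x + z + s) / 2) * ((x + z + s) / 2) - (x + z) * ((x + z + s) / 2) + (x * z - y * y) =
        (s\<^sup>2 - ((x + z)\<^sup>2 - 4 * (x * z - y * y))) / 4"
      "((x + z - s) / 2) * ((x + z - s) / 2) - (x + z) * ((x + z - s) / 2) + (x * z - y * y) =
        (s\<^sup>2 - ((x + z)\<^sup>2 - 4 * (x * z - y * y))) / 4"
      by (simp_all add: field_simps power2_eq_square)
    then show "is_eigenvalue M ((x + z + s) / 2)" "is_eigenvalue M ((x + z - s) / 2)"
      unfolding M_def s2 by (auto intro!: is_eigenvalue_sym2[OF y])
  qed
  show "\<exists>l m. 0 < l \<and> m < 0 \<and> is_eigenvalue M l \<and> is_eigenvalue M m" if "x * z - y * y < 0"
  proof -
    have "\<bar>x + z\<bar>\<^sup>2 < s\<^sup>2" unfolding s2 power2_abs using that by simp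
    then have "\<bar>x + z\<bar> < s" by (rule power_less_imp_less_base) (use s in simp)
    then have "0 < (x + z + s) / 2" "(x + z - s) / 2 < 0" unfolding abs_less_iff by simp_all
    then show ?thesis using eig by (meson exI conjI)
  qed
  show "\<exists>l m. l \<noteq> m \<and> l < 0 \<and> m < 0 \<and> is_eigenvalue M l \<and> is_eigenvalue M m"
    if "0 < x * z - y * y" "x + z < 0"
  proof -
    have "s\<^sup>2 < (- (x + z))\<^sup>2" unfolding power2_minus s2 using that by simp
    then have "s < - (x + z)"
      by (rule power_less_imp_less_base) (use that in simp)
    then have "(x + z + s) / 2 \<noteq> (x + z - s) / 2" "(x + z + s) / 2 < 0" "(x + z - s) / 2 < 0"
      using s by simp_all
    then show ?thesis using eig by (meson exI conjI)
  qed
qed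

definition g' :: "real \<Rightarrow> real \<Rightarrow> real" where
  "g' u a = 2 * (1 + a) * u - 3 * u\<^sup>2 - a"

lemma D12_G_eq:
  "D12_G u v a d = vector [vector [g' u a - 2 * d, 2 * d], vector [2 * d, g' v a - 2 * d]]"
    (is "_ = ?M")
proof -
  define x :: "real ^ 2" where "x = vector [u, v]"
  have nth: "((\<lambda>w::real^2. w $ i) has_derivative (\<lambda>w. w $ i)) (at x)" for i
    by (rule bounded_linear_imp_has_derivative[OF bounded_linear_vec_nth])
  have "((\<lambda>u. g u a) has_real_derivative g' u a) (at u)" for u
    unfolding g_def g'_def
    by (auto intro!: derivative_eq_intros simp: power2_eq_square algebra_simps)
  then have g: "((\<lambda>w::real^2. g (w $ i) a) has_derivative (\<lambda>w. g' (x $ i) a * w $ i)) (at x)" for i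
    by (intro has_derivative_compose[OF nth]) (simp add: has_field_derivative_def)
  have "((\<lambda>w. 2 * d * (w $ 2 - w $ 1) + g (w $ 1) a) has_derivative
      (\<lambda>w. 2 * d * (w $ 2 - w $ 1) + g' (x $ 1) a * w $ 1)) (at x)"
    by (intro has_derivative_add has_derivative_mult_right has_derivative_diff nth g)
  moreover have "((\<lambda>w. 2 * d * (w $ 1 - w $ 2) + g (w $ 2) a) has_derivative
      (\<lambda>w. 2 * d * (w $ 1 - w $ 2) + g' (x $ 2) a * w $ 2)) (at x)"
    by (intro has_derivative_add has_derivative_mult_right has_derivative_diff nth g)
  moreover have "(?M *v w) $ 1 = 2 * d * (w $ 2 - w $ 1) + g' (x $ 1) a * w $ 1"
    "(?M *v w) $ 2 = 2 * d * (w $ 1 - w $ 2) + g' (x $ 2) a * w $ 2" for w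
    by (simp_all add: x_def matrix_vector_mult_def sum_2 algebra_simps)
  ultimately have "((\<lambda>w. G (w $ 1) (w $ 2) a d $ i) has_derivative (\<lambda>w. (?M *v w) $ i)) (at x)" for i
    using exhaust_2[of i] by (auto simp: G_def)
  then have "((\<lambda>w. G (w $ 1) (w $ 2) a d) has_derivative (*v) ?M) (at x)"
    unfolding has_derivative_componentwise_within[of "\<lambda>w. G (w $ 1) (w $ 2) a d"]
    by (auto simp: Basis_vec_def inner_axis)
  then show ?thesis
    unfolding D12_G_def jacobian_def x_def
    by (simp add: frechet_derivative_at[symmetric])
qed

text \<open>The relation between \<open>h\<close> and \<open>t\<close> turns the diagonal entries
  into \<open>2 * d - 2 * h\<^sup>2 \<plusminus> 3 * h * t\<close>. The determinant becomes
  \<open>12 * h\<^sup>2 * (rad a d - t\<^sup>2)\<close>, whose sign separates the two cases.\<close>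

lemma D12_G_eigenvalues:
  fixes a d t h :: real
  defines "u \<equiv> (1 + a) / 3 + t / 2 - h" and "v \<equiv> (1 + a) / 3 + t / 2 + h"
  assumes d: "0 < d" and h: "0 < h" "h\<^sup>2 = gap2 a d t"
  shows "rad a d < t\<^sup>2 \<Longrightarrow>
      \<exists>l m. 0 < l \<and> m < 0 \<and> is_eigenvalue (D12_G u v a d) l \<and> is_eigenvalue (D12_G u v a d) m"
    and "t\<^sup>2 < rad a d \<Longrightarrow> \<exists>l m. l \<noteq> m \<and> l < 0 \<and> m < 0 \<and>
      is_eigenvalue (D12_G u v a d) l \<and> is_eigenvalue (D12_G u v a d) m"
proof -
  have "g' u a - 2 * d - (2 * d - 2 * h\<^sup>2 + 3 * h * t) = gap2 a d t - h\<^sup>2"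
    "g' v a - 2 * d - (2 * d - 2 * h\<^sup>2 - 3 * h * t) = gap2 a d t - h\<^sup>2"
    unfolding g'_def u_def v_def gap2_def rad_def by (simp_all add: field_simps power2_eq_square)
  then have entries: "g' u a - 2 * d = 2 * d - 2 * h\<^sup>2 + 3 * h * t"
      "g' v a - 2 * d = 2 * d - 2 * h\<^sup>2 - 3 * h * t"
    using h(2) by linarith+
  have "(2 * d - 2 * h\<^sup>2 + 3 * h * t) * (2 * d - 2 * h\<^sup>2 - 3 * h * t) - 2 * d * (2 * d) =
      h\<^sup>2 * (4 * h\<^sup>2 - 8 * d - 9 * t\<^sup>2)"
    by (simp add: power2_eq_square algebra_simps)
  also have "4 * h\<^sup>2 - 8 * d - 9 * t\<^sup>2 = 12 * (rad a d - t\<^sup>2)"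
    unfolding h(2) gap2_def by simp
  finally have det: "(g' u a - 2 * d) * (g' v a - 2 * d) - 2 * d * (2 * d) =
      h\<^sup>2 * (12 * (rad a d - t\<^sup>2))"
    unfolding entries .
  have trace: "(g' u a - 2 * d) + (g' v a - 2 * d) = 4 * d - 4 * gap2 a d t"
    unfolding entries h(2) by simp
  have d0: "2 * d \<noteq> 0" using d by simp
  show "\<exists>l m. 0 < l \<and> m < 0 \<and> is_eigenvalue (D12_G u v a d) l \<and> is_eigenvalue (D12_G u v a d) m"
    if "rad a d < t\<^sup>2"
  proof -
    have "h\<^sup>2 * (12 * (rad a d - t\<^sup>2)) < 0" using h(1) that by (simp add: mult_less_0_iff)
    then show ?thesis
      unfolding D12_G_eq by (intro eigenvalues_sym2(1)[OF d0]) (simp only: det)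
  qed
  show "\<exists>l m. l \<noteq> m \<and> l < 0 \<and> m < 0 \<and>
      is_eigenvalue (D12_G u v a d) l \<and> is_eigenvalue (D12_G u v a d) m"
    if "t\<^sup>2 < rad a d"
  proof -
    have "0 < h\<^sup>2 * (12 * (rad a d - t\<^sup>2))" using h(1) that by simp
    \<comment> \<open>Negative trace: \<open>t\<^sup>2 < rad a d\<close> makes
      \<open>gap2 a d t\<close> exceed \<open>2 * d\<close>.\<close>
    moreover have "4 * d - 4 * gap2 a d t < 0"
      using that d zero_le_power2[of t] unfolding gap2_def by argo
    ultimately show ?thesis
      unfolding D12_G_eq by (intro eigenvalues_sym2(2)[OF d0]) (simp_all only: det trace)
  qed
qed

section \<open>The solution branches\<close>

text \<open>The coordinate \<open>u\<close> of the zero belonging to the root chosen by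
  \<open>\<tau>\<close>. The choice depends on the cubic's parameters, so one construction serves A,
  B and C.\<close>

definition branch_low :: "(real \<times> real \<Rightarrow> real) \<Rightarrow> real \<times> real \<Rightarrow> real" where
  "branch_low \<tau> p = (1 + fst p) / 3 + \<tau> (rad (fst p) (snd p), off (fst p)) / 2
    - sqrt (gap2 (fst p) (snd p) (\<tau> (rad (fst p) (snd p), off (fst p))))"

definition branch_high :: "(real \<times> real \<Rightarrow> real) \<Rightarrow> real \<times> real \<Rightarrow> real" where
  "branch_high \<tau> p = (1 + fst p) / 3 + \<tau> (rad (fst p) (snd p), off (fst p)) / 2
    + sqrt (gap2 (fst p) (snd p) (\<tau> (rad (fst p) (snd p), off (fst p))))"

lemma branch_value:
  assumes "\<tau> (rad a d, off a) = t" "gap2 a d t = h\<^sup>2" "0 \<le> h"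
  shows "(branch_low \<tau> (a, d), branch_high \<tau> (a, d)) =
    ((1 + a) / 3 + t / 2 - h, (1 + a) / 3 + t / 2 + h)"
  using assms by (simp add: branch_low_def branch_high_def)

lemma continuous_on_rad_off: "continuous_on S (\<lambda>p. (rad (fst p) (snd p), off (fst p)))"
  unfolding rad_def off_def by (auto intro!: continuous_intros)

lemma Omega_minus_disc:
  assumes "is_d_minus dm" "(a, d) \<in> Omega_minus dm"
  shows "(off a)\<^sup>2 < 4 * rad a d ^ 3" "0 \<le> rad a d"
proof -
  show "(off a)\<^sup>2 < 4 * rad a d ^ 3"
    using assms is_d_minusD(5)[OF assms(1), of a d]
    by (intro card_roots_9_imp) (auto simp: Omega_minus_def)
  then show "0 \<le> rad a d" using nonneg_if_square_le_cube[of "off a"] by simp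
qed

text \<open>Inside the region there are nine zeros, hence a positive discriminant; continuity and
  closedness of \<open>three_real\<close> extend membership to the closure.\<close>

lemma closure_Omega_minus_three_real:
  assumes dm: "is_d_minus dm" and p: "p \<in> closure (Omega_minus dm)"
  shows "(rad (fst p) (snd p), off (fst p)) \<in> three_real"
proof -
  have "(\<lambda>p. (rad (fst p) (snd p), off (fst p))) ` Omega_minus dm \<subseteq> three_real"
  proof clarsimp
    fix a d assume ad: "(a, d) \<in> Omega_minus dm"
    then show "(rad a d, off a) \<in> three_real"
      using Omega_minus_disc[OF dm ad] rad_le[of a d]
      by (simp add: three_real_def Omega_minus_def)
  qed
  from image_closure_subset[OF continuous_on_rad_off closed_three_real this] p show ?thesis by auto
qed

section \<open>Properties of the branch given by one root selection\<close>

context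
  fixes dm :: "real \<Rightarrow> real" and \<tau> :: "real \<times> real \<Rightarrow> real"
  assumes dm: "is_d_minus dm"
    and cont: "continuous_on three_real \<tau>"
    and root: "\<And>r q. (r, q) \<in> three_real \<Longrightarrow> cubic r q (\<tau> (r, q)) = 0 \<and> \<bar>\<tau> (r, q)\<bar> \<le> 2 * sqrt r"
begin

lemma branch_gap2:
  assumes "(a, d) \<in> closure (Omega_minus dm)"
  shows "2 * d \<le> gap2 a d (\<tau> (rad a d, off a))" "0 \<le> d"
  using closure_Omega_minus_three_real[OF dm assms] root gap2_ge assms
  by (auto simp: three_real_def closure_Omega_minus[OF dm])

lemma branch_zero:
  assumes "(a, d) \<in> closure (Omega_minus dm)"
  shows "G (branch_low \<tau> (a, d)) (branch_high \<tau> (a, d)) a d = 0"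
  using closure_Omega_minus_three_real[OF dm assms] root branch_gap2[OF assms]
  by (auto simp: branch_low_def branch_high_def intro!: G_zeroI)

lemma branch_location:
  assumes ad: "(a, d) \<in> Omega_minus dm"
  shows "0 < branch_low \<tau> (a, d)" "branch_low \<tau> (a, d) < a"
    "a < branch_high \<tau> (a, d)" "branch_high \<tau> (a, d) < 1"
proof -
  have K: "(a, d) \<in> closure (Omega_minus dm)" using ad closure_subset by blast
  have *: "0 < d" "0 < a" "a < 1" using ad by (auto simp: Omega_minus_def)
  have "branch_low \<tau> (a, d) < branch_high \<tau> (a, d)"
    using branch_gap2[OF K] * by (simp add: branch_low_def branch_high_def)
  then show "0 < branch_low \<tau> (a, d)" "branch_low \<tau> (a, d) < a"
    "a < branch_high \<tau> (a, d)" "branch_high \<tau> (a, d) < 1"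
    using G_zero_location[OF branch_zero[OF K]] * by blast+
qed

lemma branch_continuous:
  "continuous_on (closure (Omega_minus dm)) (\<lambda>p. (branch_low \<tau> p, branch_high \<tau> p))"
proof -
  have "continuous_on (closure (Omega_minus dm)) (\<lambda>p. \<tau> (rad (fst p) (snd p), off (fst p)))"
    by (rule continuous_on_compose2[OF cont continuous_on_rad_off])
      (use closure_Omega_minus_three_real[OF dm] in blast)
  then show ?thesis
    unfolding branch_low_def branch_high_def gap2_def unfolding rad_def
    by (auto intro!: continuous_intros)
qed

text \<open>The location of zeros is available only for \<open>0 < d\<close>; continuity carries the
  bounds to the closure.\<close>

lemma branch_range:
  "(\<lambda>p. (branch_low \<tau> p, branch_high \<tau> p)) ` closure (Omega_minus dm) \<subseteq> {0..1} \<times> {0..1}"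
proof (rule image_closure_subset[OF branch_continuous])
  show "(\<lambda>p. (branch_low \<tau> p, branch_high \<tau> p)) ` Omega_minus dm \<subseteq> {0..1} \<times> {0..1}"
  proof (rule image_subsetI)
    fix p assume "p \<in> Omega_minus dm"
    then show "(branch_low \<tau> p, branch_high \<tau> p) \<in> {0..1} \<times> {0..1}"
      using branch_location[of "fst p" "snd p"] by (auto simp: Omega_minus_def)
  qed
qed (intro closed_Times closed_real_atLeastAtMost)

lemma branch_eigenvalues:
  assumes ad: "(a, d) \<in> Omega_minus dm"
  defines "M \<equiv> D12_G (branch_low \<tau> (a, d)) (branch_high \<tau> (a, d)) a d"
    and "t \<equiv> \<tau> (rad a d, off a)"
  shows "rad a d < t\<^sup>2 \<Longrightarrow> \<exists>l m. 0 < l \<and> m < 0 \<and> is_eigenvalue M l \<and> is_eigenvalue M m"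
    and "t\<^sup>2 < rad a d \<Longrightarrow>
      \<exists>l m. l \<noteq> m \<and> l < 0 \<and> m < 0 \<and> is_eigenvalue M l \<and> is_eigenvalue M m"
proof -
  have K: "(a, d) \<in> closure (Omega_minus dm)" using ad closure_subset by blast
  have d: "0 < d" using ad by (auto simp: Omega_minus_def)
  then have "0 < gap2 a d t" using branch_gap2[OF K] by (simp add: t_def)
  then have h: "0 < sqrt (gap2 a d t)" "(sqrt (gap2 a d t))\<^sup>2 = gap2 a d t" by simp_all
  show "rad a d < t\<^sup>2 \<Longrightarrow> \<exists>l m. 0 < l \<and> m < 0 \<and> is_eigenvalue M l \<and> is_eigenvalue M m"
    "t\<^sup>2 < rad a d \<Longrightarrow> \<exists>l m. l \<noteq> m \<and> l < 0 \<and> m < 0 \<and> is_eigenvalue M l \<and> is_eigenvalue M m"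
    using D12_G_eigenvalues[OF d h] unfolding M_def branch_low_def branch_high_def t_def by simp_all
qed

end

text \<open>The sum of the two coordinates is \<open>t\<close> plus a term depending only on
  \<open>a\<close>, so the order of the roots becomes the order of the sums.\<close>

lemma branches_less:
  assumes zero: "G (branch_low \<sigma> (a, d)) (branch_high \<sigma> (a, d)) a d = 0"
      "G (branch_low \<tau> (a, d)) (branch_high \<tau> (a, d)) a d = 0"
    and "branch_low \<sigma> (a, d) < branch_high \<sigma> (a, d)" "branch_low \<tau> (a, d) < branch_high \<tau> (a, d)"
    and "0 < d" "\<sigma> (rad a d, off a) < \<tau> (rad a d, off a)"
  shows "branch_low \<sigma> (a, d) < branch_low \<tau> (a, d) \<and> branch_high \<sigma> (a, d) < branch_high \<tau> (a, d)"
proof (rule G_zeros_comonotone[OF zero])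
  show "branch_low \<sigma> (a, d) + branch_high \<sigma> (a, d) < branch_low \<tau> (a, d) + branch_high \<tau> (a, d)"
    using assms(6) by (simp add: branch_low_def branch_high_def)
qed (use assms in auto)

section \<open>Values of the branches at \<open>d = 0\<close>\<close>

text \<open>These are the values of \<open>u + v - 2 * (1 + a) / 3\<close> at the zeros (0, a), (0,
  1) and (a, 1).\<close>

lemma cubic_at_d_0:
  "cubic (rad a 0) (off a) ((a - 2) / 3) = 0"
  "cubic (rad a 0) (off a) ((1 - 2 * a) / 3) = 0"
  "cubic (rad a 0) (off a) ((1 + a) / 3) = 0"
  by (simp_all add: cubic_def rad_def off_def field_simps power2_eq_square power3_eq_cube)

lemma gap2_at_d_0:
  "gap2 a 0 ((a - 2) / 3) = (a / 2)\<^sup>2"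
  "gap2 a 0 ((1 - 2 * a) / 3) = (1 / 2)\<^sup>2"
  "gap2 a 0 ((1 + a) / 3) = ((1 - a) / 2)\<^sup>2"
  by (simp_all add: gap2_def rad_def field_simps power2_eq_square)

text \<open>Assigns each explicit root to its interval, so that uniqueness identifies it with a
  selected root.\<close>

lemma sqrt_rad_at_d_0:
  assumes "0 \<le> a" "a \<le> 1"
  shows "(a - 2) / 3 \<le> - sqrt (rad a 0)" "\<bar>(1 - 2 * a) / 3\<bar> \<le> sqrt (rad a 0)"
    "sqrt (rad a 0) \<le> (1 + a) / 3"
proof -
  have "a * a \<le> a" using assms mult_left_le[of a a] by simp
  then have "rad a 0 \<le> ((2 - a) / 3)\<^sup>2" "((1 - 2 * a) / 3)\<^sup>2 \<le> rad a 0"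
    "rad a 0 \<le> ((1 + a) / 3)\<^sup>2"
    using assms by (simp_all add: rad_def field_simps power2_eq_square)
  from this[THEN real_sqrt_le_mono] have "sqrt (rad a 0) \<le> (2 - a) / 3" "\<bar>(1 - 2 * a) / 3\<bar> \<le> sqrt (rad a 0)"
    "sqrt (rad a 0) \<le> (1 + a) / 3"
    using assms unfolding real_sqrt_abs by simp_all
  then show "(a - 2) / 3 \<le> - sqrt (rad a 0)" "\<bar>(1 - 2 * a) / 3\<bar> \<le> sqrt (rad a 0)"
    "sqrt (rad a 0) \<le> (1 + a) / 3" by auto
qed

theorem proposition3p2:
  fixes d_minus :: "real \<Rightarrow> real"
  assumes "is_d_minus d_minus"
  shows "\<exists>(u\<^sub>A :: real \<times> real \<Rightarrow> real) (v\<^sub>A :: real \<times> real \<Rightarrow> real)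
           (u\<^sub>B :: real \<times> real \<Rightarrow> real) (v\<^sub>B :: real \<times> real \<Rightarrow> real)
           (u\<^sub>C :: real \<times> real \<Rightarrow> real) (v\<^sub>C :: real \<times> real \<Rightarrow> real).
    (\<forall>(u, v) \<in> {(u\<^sub>A, v\<^sub>A), (u\<^sub>B, v\<^sub>B), (u\<^sub>C, v\<^sub>C)}.
       continuous_on (closure (Omega_minus d_minus)) (\<lambda>p. (u p, v p)) \<and>
       (\<lambda>p. (u p, v p)) ` closure (Omega_minus d_minus) \<subseteq> {0..1} \<times> {0..1}) \<and>
    (\<forall>(a, d) \<in> closure (Omega_minus d_minus).
       \<forall>(u, v) \<in> {(u\<^sub>A, v\<^sub>A), (u\<^sub>B, v\<^sub>B), (u\<^sub>C, v\<^sub>C)}. G (u (a, d)) (v (a, d)) a d = 0) \<and>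
    (\<forall>(a, d) \<in> Omega_minus d_minus.
       (\<exists>l m. l \<noteq> m \<and> l < 0 \<and> m < 0 \<and>
          is_eigenvalue (D12_G (u\<^sub>B (a, d)) (v\<^sub>B (a, d)) a d) l \<and>
          is_eigenvalue (D12_G (u\<^sub>B (a, d)) (v\<^sub>B (a, d)) a d) m) \<and>
       (\<forall>(u, v) \<in> {(u\<^sub>A, v\<^sub>A), (u\<^sub>C, v\<^sub>C)}.
          \<exists>l m. 0 < l \<and> m < 0 \<and>
            is_eigenvalue (D12_G (u (a, d)) (v (a, d)) a d) l \<and>
            is_eigenvalue (D12_G (u (a, d)) (v (a, d)) a d) m)) \<and>
    (\<forall>a \<in> {0..1}.
       (u\<^sub>A (a, 0), v\<^sub>A (a, 0)) = (0, a) \<and>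
       (u\<^sub>B (a, 0), v\<^sub>B (a, 0)) = (0, 1) \<and>
       (u\<^sub>C (a, 0), v\<^sub>C (a, 0)) = (a, 1)) \<and>
    (\<forall>(a, d) \<in> Omega_minus d_minus.
       0 < u\<^sub>A (a, d) \<and> u\<^sub>A (a, d) < u\<^sub>B (a, d) \<and> u\<^sub>B (a, d) < u\<^sub>C (a, d) \<and> u\<^sub>C (a, d) < a \<and>
       a < v\<^sub>A (a, d) \<and> v\<^sub>A (a, d) < v\<^sub>B (a, d) \<and> v\<^sub>B (a, d) < v\<^sub>C (a, d)) \<and>
    (\<forall>a \<in> {0..1/2}.
       (u\<^sub>B (a, d_minus a), v\<^sub>B (a, d_minus a)) = (u\<^sub>C (a, d_minus a), v\<^sub>C (a, d_minus a))) \<and>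
    (\<forall>a \<in> {1/2..1}.
       (u\<^sub>A (a, d_minus a), v\<^sub>A (a, d_minus a)) = (u\<^sub>B (a, d_minus a), v\<^sub>B (a, d_minus a)))"
proof -
  note dm = assms
  let ?K = "closure (Omega_minus d_minus)"
  obtain x y z where cont: "continuous_on three_real x" "continuous_on three_real y"
      "continuous_on three_real z"
    and roots: "\<And>r q. (r, q) \<in> three_real \<Longrightarrow>
      cubic r q (x (r, q)) = 0 \<and> - (2 * sqrt r) \<le> x (r, q) \<and> x (r, q) \<le> - sqrt r \<and>
      cubic r q (y (r, q)) = 0 \<and> - sqrt r \<le> y (r, q) \<and> y (r, q) \<le> sqrt r \<and>
      cubic r q (z (r, q)) = 0 \<and> sqrt r \<le> z (r, q) \<and> z (r, q) \<le> 2 * sqrt r"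
    using cubic_roots_continuous by (metis (no_types, lifting))
  have sqrt_nonneg: "0 \<le> sqrt r" if "(r, q) \<in> three_real" for r q
    using that by (simp add: three_real_def)
  \<comment> \<open>The common bound under which the branch lemmas apply to all three
    selections.\<close>
  have "cubic r q (x (r, q)) = 0 \<and> \<bar>x (r, q)\<bar> \<le> 2 * sqrt r"
    "cubic r q (y (r, q)) = 0 \<and> \<bar>y (r, q)\<bar> \<le> 2 * sqrt r"
    "cubic r q (z (r, q)) = 0 \<and> \<bar>z (r, q)\<bar> \<le> 2 * sqrt r" if "(r, q) \<in> three_real" for r q
    using roots[OF that] sqrt_nonneg[OF that] by auto
  note X = dm cont(1) this(1) and Y = dm cont(2) this(2) and Z = dm cont(3) this(3)
  have unique_x: "x (r, q) = t" if "(r, q) \<in> three_real" "cubic r q t = 0" "t \<le> - sqrt r" for r q t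
    using cubic_root_unique[of r q "x (r, q)" t] roots[OF that(1)] that
    by (simp add: three_real_def)
  have unique_y: "y (r, q) = t" if "(r, q) \<in> three_real" "cubic r q t = 0" "\<bar>t\<bar> \<le> sqrt r" for r q t
    using cubic_root_unique[of r q "y (r, q)" t] roots[OF that(1)] that
    by (simp add: three_real_def abs_le_iff)
  have unique_z: "z (r, q) = t" if "(r, q) \<in> three_real" "cubic r q t = 0" "sqrt r \<le> t" for r q t
    using cubic_root_unique[of r q "z (r, q)" t] roots[OF that(1)] that
    by (simp add: three_real_def)
  have K: "(a, d) \<in> ?K \<longleftrightarrow> 0 \<le> a \<and> a \<le> 1 \<and> 0 \<le> d \<and> d \<le> d_minus a" for a d
    by (simp add: closure_Omega_minus[OF dm])
  have R: "(rad a d, off a) \<in> three_real" if "(a, d) \<in> ?K" for a d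
    using closure_Omega_minus_three_real[OF dm that] by simp
  have dm_nonneg: "0 \<le> d_minus a" if "a \<in> {0..1}" for a
    using is_d_minusD(2)[OF dm] that by fastforce
  \<comment> \<open>Inside the region no root is a critical point, so the interval bounds become
    strict.\<close>
  have Omega: "x (rad a d, off a) < - sqrt (rad a d) \<and> - sqrt (rad a d) < y (rad a d, off a) \<and>
      y (rad a d, off a) < sqrt (rad a d) \<and> sqrt (rad a d) < z (rad a d, off a) \<and>
      (a, d) \<in> ?K \<and> 0 < d \<and> 0 \<le> rad a d" if "(a, d) \<in> Omega_minus d_minus" for a d
  proof -
    have ad: "(a, d) \<in> ?K" using that closure_subset by blast
    note disc = Omega_minus_disc[OF dm that]
    note nz = cubic_sqrt_nonzero(1,2)[OF disc(2,1)]
    have "x (rad a d, off a) \<noteq> - sqrt (rad a d)" "y (rad a d, off a) \<noteq> - sqrt (rad a d)"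
      "y (rad a d, off a) \<noteq> sqrt (rad a d)" "z (rad a d, off a) \<noteq> sqrt (rad a d)"
      using nz roots[OF R[OF ad]] by metis+
    then show ?thesis
      using roots[OF R[OF ad]] ad that disc(2) by (auto simp: Omega_minus_def)
  qed
  have eig: "(\<exists>l m. l \<noteq> m \<and> l < 0 \<and> m < 0 \<and>
          is_eigenvalue (D12_G (branch_low y (a, d)) (branch_high y (a, d)) a d) l \<and>
          is_eigenvalue (D12_G (branch_low y (a, d)) (branch_high y (a, d)) a d) m) \<and>
       (\<forall>(u, v) \<in> {(branch_low x, branch_high x), (branch_low z, branch_high z)}.
          \<exists>l m. 0 < l \<and> m < 0 \<and>
            is_eigenvalue (D12_G (u (a, d)) (v (a, d)) a d) l \<and>
            is_eigenvalue (D12_G (u (a, d)) (v (a, d)) a d) m)"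
    if ad: "(a, d) \<in> Omega_minus d_minus" for a d
  proof -
    have "0 \<le> sqrt (rad a d)" using Omega[OF ad] by simp
    then have "\<bar>y (rad a d, off a)\<bar> < \<bar>sqrt (rad a d)\<bar>"
      "\<bar>sqrt (rad a d)\<bar> < \<bar>x (rad a d, off a)\<bar>" "\<bar>sqrt (rad a d)\<bar> < \<bar>z (rad a d, off a)\<bar>"
      using Omega[OF ad] by auto
    from this[THEN power2_strict_mono] have "(y (rad a d, off a))\<^sup>2 < rad a d" "rad a d < (x (rad a d, off a))\<^sup>2"
      "rad a d < (z (rad a d, off a))\<^sup>2"
      using Omega[OF ad] by simp_all
    then show ?thesis
      using branch_eigenvalues(2)[OF Y ad] branch_eigenvalues(1)[OF X ad]
        branch_eigenvalues(1)[OF Z ad] by simp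
  qed
  have order: "0 < branch_low x (a, d) \<and> branch_low x (a, d) < branch_low y (a, d) \<and>
      branch_low y (a, d) < branch_low z (a, d) \<and> branch_low z (a, d) < a \<and>
      a < branch_high x (a, d) \<and> branch_high x (a, d) < branch_high y (a, d) \<and>
      branch_high y (a, d) < branch_high z (a, d)" if ad: "(a, d) \<in> Omega_minus d_minus" for a d
  proof -
    note loc = branch_location[OF X ad] branch_location[OF Y ad] branch_location[OF Z ad]
    have *: "(a, d) \<in> ?K" "0 < d" "x (rad a d, off a) < y (rad a d, off a)"
      "y (rad a d, off a) < z (rad a d, off a)"
      using Omega[OF ad] by auto
    show ?thesis
      using branches_less[OF branch_zero[OF X *(1)] branch_zero[OF Y *(1)] _ _ *(2,3)]
        branches_less[OF branch_zero[OF Y *(1)] branch_zero[OF Z *(1)] _ _ *(2,4)] loc by auto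
  qed
  have start: "(branch_low x (a, 0), branch_high x (a, 0)) = (0, a) \<and>
      (branch_low y (a, 0), branch_high y (a, 0)) = (0, 1) \<and>
      (branch_low z (a, 0), branch_high z (a, 0)) = (a, 1)" if a: "a \<in> {0..1}" for a
  proof -
    have "(a, 0) \<in> ?K" using K dm_nonneg[OF a] a by simp
    note R = R[OF this]
    have "x (rad a 0, off a) = (a - 2) / 3" "y (rad a 0, off a) = (1 - 2 * a) / 3"
      "z (rad a 0, off a) = (1 + a) / 3"
      using unique_x[OF R] unique_y[OF R] unique_z[OF R] cubic_at_d_0[of a] sqrt_rad_at_d_0[of a] a
      by simp_all
    then show ?thesis
      using branch_value[OF _ gap2_at_d_0(1), of x a] branch_value[OF _ gap2_at_d_0(2), of y a]
        branch_value[OF _ gap2_at_d_0(3), of z a] a by (simp add: field_simps)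
  qed
  have end_left: "(branch_low y (a, d_minus a), branch_high y (a, d_minus a)) =
      (branch_low z (a, d_minus a), branch_high z (a, d_minus a))" if a: "a \<in> {0..1/2}" for a
  proof -
    have aK: "(a, d_minus a) \<in> ?K" using K dm_nonneg[of a] a by simp
    note R = R[OF this]
    have r: "0 \<le> rad a (d_minus a)" using R by (simp add: three_real_def)
    \<comment> \<open>The double root is then \<open>sqrt r\<close>, the common endpoint of the
      intervals of \<open>y\<close> and \<open>z\<close>; uniqueness in each makes both selections
      equal to it.\<close>
    have "0 \<le> off a" using a by (simp add: off_def)
    then have "cubic (rad a (d_minus a)) (off a) (sqrt (rad a (d_minus a))) = 0"
      using cubic_double_root(1)[OF r] disc_at_d_minus[OF dm, of a] a by simp
    then have "y (rad a (d_minus a), off a) = z (rad a (d_minus a), off a)"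
      using unique_y[OF R] unique_z[OF R] r by simp
    then show ?thesis by (simp add: branch_low_def branch_high_def)
  qed
  have end_right: "(branch_low x (a, d_minus a), branch_high x (a, d_minus a)) =
      (branch_low y (a, d_minus a), branch_high y (a, d_minus a))" if a: "a \<in> {1/2..1}" for a
  proof -
    have aK: "(a, d_minus a) \<in> ?K" using K dm_nonneg[of a] a by simp
    note R = R[OF this]
    have r: "0 \<le> rad a (d_minus a)" using R by (simp add: three_real_def)
    \<comment> \<open>Now the double root is \<open>- sqrt r\<close>, shared by the intervals of
      \<open>x\<close> and \<open>y\<close>.\<close>
    have "off a \<le> 0" using a by (simp add: off_def mult_nonneg_nonpos mult_nonpos_nonneg)
    then have "cubic (rad a (d_minus a)) (off a) (- sqrt (rad a (d_minus a))) = 0"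
      using cubic_double_root(2)[OF r] disc_at_d_minus[OF dm, of a] a by simp
    then have "x (rad a (d_minus a), off a) = y (rad a (d_minus a), off a)"
      using unique_x[OF R] unique_y[OF R] r by simp
    then show ?thesis by (simp add: branch_low_def branch_high_def)
  qed
  show ?thesis
  \<comment> \<open>The witnesses stay schematic until the first \<open>show\<close> fixes A, B, C
    as the branches of \<open>x\<close>, \<open>y\<close>, \<open>z\<close>.\<close>
  proof (intro exI conjI)
    show "\<forall>(u, v) \<in> {(branch_low x, branch_high x), (branch_low y, branch_high y),
        (branch_low z, branch_high z)}. continuous_on ?K (\<lambda>p. (u p, v p)) \<and>
        (\<lambda>p. (u p, v p)) ` ?K \<subseteq> {0..1} \<times> {0..1}"
      using branch_continuous[OF X] branch_continuous[OF Y] branch_continuous[OF Z]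
        branch_range[OF X] branch_range[OF Y] branch_range[OF Z] by simp
    show "\<forall>(a, d) \<in> ?K. \<forall>(u, v) \<in> {(branch_low x, branch_high x), (branch_low y, branch_high y),
        (branch_low z, branch_high z)}. G (u (a, d)) (v (a, d)) a d = 0"
      using branch_zero[OF X] branch_zero[OF Y] branch_zero[OF Z] by auto
  qed (use eig order start end_left end_right in blast)+
qed

end
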